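(* Let $N\ge1$, let $\mathbb E$ be a diagonal $N\times N$ matrix with $\mathbb E^2=\mathbb I_N$, let $a\in\mathbb R$, $\varepsilon_-\in\{1,-1\}$, and let $A,B,C,\omega$ be real-valued functions on $\mathbb R$ with $A(-k)=-A(k)$, $B(-k)=B(k)$, $C(-k)=-C(k)$, $\omega(-k)=-\varepsilon_-\omega(k)$. Put $\varepsilon_+=1$ and $$\rho_\pm(k)=\varepsilon_\pm\frac{A(k)-i}{A(k)+i}\,\frac{C(k)\mp i}{C(k)\pm i}\,\frac{1-\omega(k)^2}{1+\omega(k)^2},\qquad\tau_\pm(k)=\frac{B(k)\mp i}{B(k)\pm i}\,\frac{C(k)\mp i}{C(k)\pm i}\,\frac{2\omega(k)}{1+\omega(k)^2},$$ $$f(k)=(A(k)+i)(B(k)+i)(C(k)+i),\qquad g(k)=(A(k)+i)(B(k)-i)(C(k)-i).$$ Let $R_\pm(k),T_\pm(k)$ be the reflection and transmission matrices of the quantum field $\Phi$ of the $N$-component nonlinear Schrödinger model with defect, so that its matrix elements have the form $$\langle\varphi,\Phi(t,x)\psi\rangle=\int\frac{dk}{2\pi}e^{-ik^2t}\big(\Psi^+_k(x)\chi^+(k)+\Psi^-_k(x)\chi^-(k)\big),$$ $$\Psi^\pm_k(x)=\theta(\mp k)\big[\theta(\mp x)T_\mp(k)e^{ikx}+\theta(\pm x)\big(\mathbb I_Ne^{ikx}+R_\pm(-k)e^{-ikx}\big)\big],$$ with $\mathbb C^N$-valued wave packets $\chi^\pm$. Then, for all times $t$, $\Phi$ obeys (in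 mean value) the following boundary conditions at $x=0$. (1) If $R_\pm=\rho_\pm\mathbb I_N$, $T_\pm=\tau_\pm\mathbb I_N$: $$2D_fD_\omega\Phi(+0)=\big(1-\varepsilon_-+(1+\varepsilon_-)D_\omega^2\big)D_g\Phi(-0),$$ $$2D_fD_\omega\partial_x\Phi(+0)=\big(1+\varepsilon_-+(1-\varepsilon_-)D_\omega^2\big)D_g\partial_x\Phi(-0).$$ (2) If $R_\pm=\rho_\pm\mathbb E$, $T_\pm=\tau_\pm\mathbb E$: $$D_fD_\omega\Phi(+0)=\varepsilon_-\Big(\tfrac{\mathbb I_N+\varepsilon_-\mathbb E}{2}D_\omega^2-\tfrac{\mathbb I_N-\varepsilon_-\mathbb E}{2}\Big)D_g\Phi(-0),$$ $$D_fD_\omega\partial_x\Phi(+0)=\varepsilon_-\Big(\tfrac{\mathbb I_N+\varepsilon_-\mathbb E}{2}-\tfrac{\mathbb I_N-\varepsilon_-\mathbb E}{2}D_\omega^2\Big)D_g\partial_x\Phi(-0).$$ (3) If $R_\pm(k)=\rho_\pm(k)\frac{\mathbb I_N\pm iak\mathbb E}{1\pm iak}$, $T_\pm(k)=\tau_\pm(k)\frac{\mathbb I_N\pm iak\mathbb E}{1\pm iak}$: $$D_fD_\omega(1+a\partial_x)\Phi(+0)=\Big(\tfrac{1-\varepsilon_-}{2}+\tfrac{1+\varepsilon_-}{2}D_\omega^2\Big)D_g\Phi(-0)+a\varepsilon_-\Big(\tfrac{\mathbb I_N+\varepsilon_-\mathbb E}{2}-\tfrac{\mathbb I_N-\varepsilon_-\mathbb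 E}{2}D_\omega^2\Big)D_g\partial_x\Phi(-0),$$ $$D_fD_\omega(1+a\partial_x)\partial_x\Phi(+0)=\Big(\tfrac{1+\varepsilon_-}{2}+\tfrac{1-\varepsilon_-}{2}D_\omega^2\Big)D_g\partial_x\Phi(-0)-a\varepsilon_-\Big(\tfrac{\mathbb I_N-\varepsilon_-\mathbb E}{2}-\tfrac{\mathbb I_N+\varepsilon_-\mathbb E}{2}D_\omega^2\Big)D_g\partial_x^2\Phi(-0).$$
   Context: For a (scalar or matrix-valued) function $A(k)$, $D_A$ is the operator $(D_Af)(y)=\int dx\,\hat A(x)f(x+y)$ with $\hat A$ the inverse Fourier transform of $A$, normalized so that $D_A$ acts on plane waves by multiplication: $D_Ae^{iky}=A(k)e^{iky}$. Thus $D_{(k)}=-i\,d/dy$, $D_c=c$ for a constant $c$, and $D_{AB}=D_AD_B$. $D_\omega$ denotes the operator attached to the function $\omega$, etc. Meaning of the boundary conditions: "$D\,\Phi(+0)=D'\,\Phi(-0)$" means $\lim_{x\downarrow0}D\langle\varphi,\Phi(t,x)\psi\rangle=\lim_{x\uparrow0}D'\langle\varphi,\Phi(t,x)\psi\rangle$ for all matrix elements (all $\varphi,\psi$ in the finite particle domain) and all $t$. On each side of $0$ the operators act under the $k$-integral on the plane-wave expressions $e^{\pm ikx}$ appearing in $\Psi^\pm_k(x)$ for that sign of $x$ (i.e. $D_A$ multiplies $e^{ikx}$ by $A(k)$ and $e^{-ikx}$ by $A(-k)$). The wave packets $\chi^\pm$ are assumed to decay fast enough for all integrals to converge. $\theta$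 in $\Psi^\pm_k$ is the Heaviside function. The function called $g(k)$ here is not the coupling constant. *)

theory Defs
  imports "HOL-Analysis.Analysis" "HOL-Library.Function_Algebras"
begin

text \<open>The upper/lower sign labels of the reflection and transmission matrices, of the two families
  of plane waves and of the two half-lines.\<close>

datatype sign = Pos | Neg

fun sg :: "sign \<Rightarrow> real" where
  "sg Pos = 1"
| "sg Neg = -1"

fun opp :: "sign \<Rightarrow> sign" where
  "opp Pos = Neg"
| "opp Neg = Pos"

text \<open>Heaviside function; the value at \<open>0\<close> is immaterial below, where it only concerns
  the null set \<open>k = 0\<close> and the excluded point \<open>x = 0\<close>.\<close>

definition heaviside :: "real \<Rightarrow> complex" where
  "heaviside y = (if y > 0 then 1 else 0)"

definition smult_mat :: "complex \<Rightarrow> complex^'n^'m \<Rightarrow> complex^'n^'m"  (infixr "*\<^sub>m" 75) where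
  "c *\<^sub>m M = (\<chi> i j. c * M $ i $ j)"

definition diagonal_mat :: "complex^'n^'n \<Rightarrow> bool" where
  "diagonal_mat M \<longleftrightarrow> (\<forall>i j. i \<noteq> j \<longrightarrow> M $ i $ j = 0)"

text \<open>The matrices \<open>\<Psi>\<^sup>\<plusminus>\<^sub>k(x)\<close>: for either choice of the sign \<open>s\<close>, \<open>\<Psi>\<^sup>s\<^sub>k\<close> contains
  \<open>R\<^sub>s\<close> on the half-line of sign \<open>s\<close> and \<open>T\<^sub>-\<^sub>s\<close> on the other one.\<close>

definition Psi ::
  "(sign \<Rightarrow> real \<Rightarrow> complex^'n^'n) \<Rightarrow> (sign \<Rightarrow> real \<Rightarrow> complex^'n^'n) \<Rightarrow> sign \<Rightarrow> real \<Rightarrow> real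
    \<Rightarrow> complex^'n^'n" where
  "Psi R T s k x = heaviside (- sg s * k) *\<^sub>m
     (heaviside (- sg s * x) *\<^sub>m cis (k * x) *\<^sub>m T (opp s) k
      + heaviside (sg s * x) *\<^sub>m (cis (k * x) *\<^sub>m mat 1 + cis (- (k * x)) *\<^sub>m R s (- k)))"

definition matrix_element_form ::
  "(sign \<Rightarrow> real \<Rightarrow> complex^'n^'n) \<Rightarrow> (sign \<Rightarrow> real \<Rightarrow> complex^'n^'n) \<Rightarrow> (sign \<Rightarrow> real \<Rightarrow> complex^'n)
    \<Rightarrow> real \<Rightarrow> real \<Rightarrow> complex^'n" where
  "matrix_element_form R T chi t x =
     (LINT k|lborel. (cis (- (k\<^sup>2 * t)) / (2 * pi)) *s
        (Psi R T Pos k x *v chi Pos k + Psi R T Neg k x *v chi Neg k))"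

text \<open>A plane-wave expression \<open>e\<^sup>i\<^sup>k\<^sup>x u(k) + e\<^sup>-\<^sup>i\<^sup>k\<^sup>x v(k)\<close> is encoded by its amplitudes
  \<open>k \<mapsto> (u(k), v(k))\<close>, so that the operators \<open>D\<^sub>A\<close> can act under the \<open>k\<close>-integral.\<close>

type_synonym 'n waves = "real \<Rightarrow> (complex^'n) \<times> (complex^'n)"

definition packet_integrand :: "'n waves \<Rightarrow> real \<Rightarrow> real \<Rightarrow> real \<Rightarrow> complex^'n" where
  "packet_integrand W t k x = (cis (- (k\<^sup>2 * t)) / (2 * pi)) *s
     (cis (k * x) *s fst (W k) + cis (- (k * x)) *s snd (W k))"

definition packet :: "'n waves \<Rightarrow> real \<Rightarrow> real \<Rightarrow> complex^'n" where
  "packet W t x = (LINT k|lborel. packet_integrand W t k x)"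

definition converges :: "'n::finite waves \<Rightarrow> bool" where
  "converges W \<longleftrightarrow> integrable lborel (\<lambda>k. fst (W k)) \<and> integrable lborel (\<lambda>k. snd (W k))"

text \<open>The plane-wave expressions to which \<open>\<Psi>\<^sup>+\<^sub>k(x)\<chi>\<^sup>+(k) + \<Psi>\<^sup>-\<^sub>k(x)\<chi>\<^sup>-(k)\<close> reduces
  for \<open>x\<close> of sign \<open>h\<close>; see \<open>Psi_eq_amplitudes\<close>.\<close>

definition amplitudes ::
  "(sign \<Rightarrow> real \<Rightarrow> complex^'n^'n) \<Rightarrow> (sign \<Rightarrow> real \<Rightarrow> complex^'n^'n) \<Rightarrow> sign \<Rightarrow> sign \<Rightarrow> real
    \<Rightarrow> (complex^'n^'n) \<times> (complex^'n^'n)" where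
  "amplitudes R T s h k =
     (if h = s then (heaviside (- sg s * k) *\<^sub>m mat 1, heaviside (- sg s * k) *\<^sub>m R s (- k))
      else (heaviside (- sg s * k) *\<^sub>m T h k, 0))"

definition half_line_waves ::
  "(sign \<Rightarrow> real \<Rightarrow> complex^'n^'n) \<Rightarrow> (sign \<Rightarrow> real \<Rightarrow> complex^'n^'n) \<Rightarrow> (sign \<Rightarrow> real \<Rightarrow> complex^'n)
    \<Rightarrow> sign \<Rightarrow> 'n waves" where
  "half_line_waves R T chi h = (\<lambda>k.
     (fst (amplitudes R T Pos h k) *v chi Pos k + fst (amplitudes R T Neg h k) *v chi Neg k,
      snd (amplitudes R T Pos h k) *v chi Pos k + snd (amplitudes R T Neg h k) *v chi Neg k))"

lemma smult_mat_simps: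
  "c *\<^sub>m (M + N) = c *\<^sub>m M + c *\<^sub>m N" "c *\<^sub>m d *\<^sub>m M = (c * d) *\<^sub>m M" "0 *\<^sub>m M = 0" "1 *\<^sub>m M = M"
  "c *\<^sub>m 0 = 0" "(c *\<^sub>m M) *v z = c *s (M *v z)" "(c *\<^sub>m M) ** N = c *\<^sub>m (M ** N)"
  by (simp_all add: smult_mat_def vec_eq_iff algebra_simps matrix_vector_mult_def
      matrix_matrix_mult_def sum_distrib_left)

lemma Psi_eq_amplitudes:
  assumes "sg h * x > 0"
  shows "Psi R T s k x = cis (k * x) *\<^sub>m fst (amplitudes R T s h k)
                       + cis (- (k * x)) *\<^sub>m snd (amplitudes R T s h k)"
  using assms
  by (cases h; cases s)
     (auto simp: Psi_def amplitudes_def heaviside_def smult_mat_simps)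

lemma matrix_element_form_eq_packet:
  assumes "sg h * x > 0"
  shows "matrix_element_form R T chi t x = packet (half_line_waves R T chi h) t x"
  unfolding matrix_element_form_def packet_def packet_integrand_def half_line_waves_def Psi_eq_amplitudes[OF assms]
  by (simp add: matrix_vector_mult_add_rdistrib smult_mat_simps vector_add_ldistrib add_ac)

text \<open>The operator \<open>D\<^sub>A\<close> of a matrix-valued \<open>A\<close>, normalized by \<open>D\<^sub>A e\<^sup>i\<^sup>k\<^sup>y = A(k) e\<^sup>i\<^sup>k\<^sup>y\<close>; hence
  it multiplies the amplitude of \<open>e\<^sup>-\<^sup>i\<^sup>k\<^sup>x\<close> by \<open>A(-k)\<close>.  For scalar-valued \<open>A\<close> use \<open>D\<^sub>s\<close>.\<close>

definition Dmat :: "(real \<Rightarrow> complex^'n^'n) \<Rightarrow> 'n::finite waves \<Rightarrow> 'n waves"  ("D\<^sub>m") where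
  "D\<^sub>m A W = (\<lambda>k. (A k *v fst (W k), A (- k) *v snd (W k)))"

definition Dscal :: "(real \<Rightarrow> complex) \<Rightarrow> 'n::finite waves \<Rightarrow> 'n waves"  ("D\<^sub>s") where
  "D\<^sub>s c = D\<^sub>m (\<lambda>k. mat (c k))"

text \<open>\<open>\<partial>\<^sub>x = i D\<^sub>(\<^sub>k\<^sub>)\<close>; see \<open>packet_has_vector_derivative\<close>.\<close>

definition deriv_x :: "'n::finite waves \<Rightarrow> 'n waves"  ("\<partial>\<^sub>x") where
  "\<partial>\<^sub>x = D\<^sub>s (\<lambda>k. \<i> * k)"

text \<open>Products of operators are compositions, while \<open>+\<close> and \<open>-\<close> on operators are pointwise.
  Constants must be entered as \<open>D\<^sub>s (\<lambda>_. c)\<close>: a bare numeral would denote a constant function.\<close>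

abbreviation op_prod :: "('n::finite waves \<Rightarrow> 'n waves) \<Rightarrow> ('n waves \<Rightarrow> 'n waves) \<Rightarrow> 'n waves \<Rightarrow> 'n waves"
  (infixl "\<cdot>" 70) where
  "D \<cdot> D' \<equiv> D \<circ> D'"

abbreviation const_op :: "complex \<Rightarrow> 'n::finite waves \<Rightarrow> 'n waves"  ("\<langle>_\<rangle>") where
  "\<langle>c\<rangle> \<equiv> D\<^sub>s (\<lambda>_. c)"

abbreviation const_mat_op :: "complex^'n^'n \<Rightarrow> 'n::finite waves \<Rightarrow> 'n waves"  ("\<lblot>_\<rblot>") where
  "\<lblot>M\<rblot> \<equiv> D\<^sub>m (\<lambda>_. M)"

lemma Dmat_mult: "D\<^sub>m (\<lambda>k. A k ** B k) = D\<^sub>m A \<cdot> D\<^sub>m B"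
  by (rule ext) (simp add: Dmat_def matrix_vector_mul_assoc)

lemma Dmat_add: "D\<^sub>m (\<lambda>k. A k + B k) = D\<^sub>m A + D\<^sub>m B"
  by (intro ext) (simp add: Dmat_def matrix_vector_mult_add_rdistrib)

lemma mat_mult_vec: "mat c *v z = c *s (z :: complex^'n)"
  by (simp add: vec_eq_iff matrix_vector_mult_def mat_def if_distrib if_distribR cong: if_cong)

lemma norm_smult_vec: "norm (c *s z) = norm c * norm (z :: complex^'n)"
  by (simp add: norm_vec_def norm_mult L2_set_right_distrib)

lemma bounded_bilinear_smult_vec: "bounded_bilinear ((*s) :: complex \<Rightarrow> complex^'n \<Rightarrow> complex^'n)"
  by (standard; (intro exI[of _ 1])?)
     (auto simp: vec_eq_iff algebra_simps norm_smult_vec)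

lemma integrable_smult_vec:
  fixes z :: "real \<Rightarrow> complex^'n"
  assumes c: "c \<in> borel_measurable lborel" "\<And>k. norm (c k) \<le> b" and z: "integrable lborel z"
  shows "integrable lborel (\<lambda>k. c k *s z k)"
proof (rule Bochner_Integration.integrable_bound)
  show "integrable lborel (\<lambda>k. b * norm (z k))"
    using z by auto
  show "(\<lambda>k. c k *s z k) \<in> borel_measurable lborel"
    using c(1) borel_measurable_integrable[OF z]
    by (rule borel_measurable_continuous_Pair)
       (intro continuous_intros bounded_bilinear.continuous_on[OF bounded_bilinear_smult_vec])
  show "AE k in lborel. norm (c k *s z k) \<le> norm (b * norm (z k))"
  proof (rule AE_I2)
    fix k
    have "norm (c k) * norm (z k) \<le> b * norm (z k)"
      by (rule mult_right_mono[OF c(2)]) simp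
    then show "norm (c k *s z k) \<le> norm (b * norm (z k))"
      by (simp add: norm_smult_vec)
  qed
qed

lemma integrable_packet_integrand:
  assumes "converges W"
  shows "integrable lborel (\<lambda>k. packet_integrand W t k x)"
proof -
  have 1: "integrable lborel (\<lambda>k. (cis (- (k\<^sup>2 * t)) / (2 * pi) * cis (k * y)) *s z k)"
    if "integrable lborel z" for z :: "real \<Rightarrow> complex^'a" and y
    by (rule integrable_smult_vec[where b = 1, OF _ _ that])
       (use pi_gt3 in \<open>auto simp: norm_mult norm_divide cis_conv_exp divide_simps\<close>)
  show ?thesis
    using Bochner_Integration.integrable_add[OF 1[of "\<lambda>k. fst (W k)" x] 1[of "\<lambda>k. snd (W k)" "- x"]] assms
    by (simp add: converges_def packet_integrand_def vector_add_ldistrib)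
qed

lemma deriv_x_apply: "\<partial>\<^sub>x W = (\<lambda>k. ((\<i> * k) *s fst (W k), (- \<i> * k) *s snd (W k)))"
  by (simp add: deriv_x_def Dscal_def Dmat_def mat_mult_vec)

lemma packet_integrand_has_vector_derivative:
  "((\<lambda>x. packet_integrand W t k x) has_vector_derivative packet_integrand (\<partial>\<^sub>x W) t k x) (at x)"
proof -
  interpret bounded_bilinear "(*s) :: complex \<Rightarrow> complex^'a \<Rightarrow> complex^'a"
    by (rule bounded_bilinear_smult_vec)
  have cis: "((\<lambda>x. cis (c * x)) has_vector_derivative \<i> * c * cis (c * x)) (at x)" for c :: real
    unfolding cis_conv_exp
    by (rule derivative_eq_intros has_vector_derivative_real_field refl | simp)+
  have *: "((\<lambda>x. (d * cis (c * x)) *s z) has_vector_derivative (d * (\<i> * c * cis (c * x))) *s z) (at x)"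
    for c :: real and d and z :: "complex^'a"
    by (rule bounded_linear.has_vector_derivative[OF bounded_linear_left])
       (rule has_vector_derivative_mult_right[OF cis])
  show ?thesis
    using has_vector_derivative_add[OF *[of "cis (- (k\<^sup>2 * t)) / (2 * pi)" k "fst (W k)"]
                                       *[of "cis (- (k\<^sup>2 * t)) / (2 * pi)" "- k" "snd (W k)"]]
    by (simp add: packet_integrand_def deriv_x_apply vector_add_ldistrib mult_ac)
qed

lemma norm_packet_integrand_le:
  "norm (packet_integrand W t k x) \<le> norm (fst (W k)) + norm (snd (W k))"
proof -
  have "norm (packet_integrand W t k x)
          \<le> 1 / (2 * pi) * norm (cis (k * x) *s fst (W k) + cis (- (k * x)) *s snd (W k))"
    by (simp add: packet_integrand_def norm_smult_vec norm_divide del: vector_add_ldistrib vector_smult_assoc)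
  also have "\<dots> \<le> 1 * norm (cis (k * x) *s fst (W k) + cis (- (k * x)) *s snd (W k))"
    by (rule mult_right_mono) (use pi_gt3 in auto)
  also have "\<dots> \<le> norm (fst (W k)) + norm (snd (W k))"
    using norm_triangle_ineq[of "cis (k * x) *s fst (W k)" "cis (- (k * x)) *s snd (W k)"]
    by (simp add: norm_smult_vec)
  finally show ?thesis .
qed

lemma has_vector_derivative_iff_quotient:
  fixes F :: "real \<Rightarrow> 'a::real_normed_vector"
  shows "(F has_vector_derivative D) (at x)
     \<longleftrightarrow> ((\<lambda>h. (1 / h) *\<^sub>R (F (x + h) - F x)) \<longlongrightarrow> D) (at 0)"
proof -
  have "norm (F (x + h) - F x - h *\<^sub>R D) / norm h = norm ((1 / h) *\<^sub>R (F (x + h) - F x) - D)"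
    if "h \<noteq> 0" for h
  proof -
    have "(1 / h) *\<^sub>R (F (x + h) - F x) - D = (1 / h) *\<^sub>R (F (x + h) - F x - h *\<^sub>R D)"
      using that by (simp add: scaleR_diff_right)
    then show ?thesis
      by (simp add: divide_inverse mult.commute)
  qed
  then have "((\<lambda>h. norm (F (x + h) - F x - h *\<^sub>R D) / norm h) \<longlongrightarrow> 0) (at 0)
     \<longleftrightarrow> ((\<lambda>h. norm ((1 / h) *\<^sub>R (F (x + h) - F x) - D)) \<longlongrightarrow> 0) (at 0)"
    by (intro tendsto_cong) (auto simp: eventually_at_filter)
  then show ?thesis
    by (simp add: has_vector_derivative_def has_derivative_at bounded_linear_scaleR_left
        tendsto_norm_zero_iff flip: LIM_zero_iff[of _ D])
qed

lemma packet_has_vector_derivative: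
  assumes W: "converges W" "converges (\<partial>\<^sub>x W)"
  shows "((\<lambda>x. packet W t x) has_vector_derivative packet (\<partial>\<^sub>x W) t x) (at x)"
proof -
  let ?K = "packet_integrand W t" and ?K' = "packet_integrand (\<partial>\<^sub>x W) t"
  define b where "b k = norm (fst ((\<partial>\<^sub>x W) k)) + norm (snd ((\<partial>\<^sub>x W) k))" for k
  define q where "q h k = (1 / h) *\<^sub>R (?K k (x + h) - ?K k x)" for h k
  note int = integrable_packet_integrand[OF W(1)] integrable_packet_integrand[OF W(2)]
  have q_int: "integrable lborel (q h)" for h
    unfolding q_def using int(1) by auto
  have q_eq: "(LINT k|lborel. q h k) = (1 / h) *\<^sub>R (packet W t (x + h) - packet W t x)" for h
    unfolding q_def packet_def using int(1) by simp
  have b_int: "integrable lborel b"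
    using W(2) unfolding b_def converges_def by auto
  have q_le: "norm (q h k) \<le> b k" for h k
  proof -
    have "norm (?K k (x + h) - ?K k x) \<le> b k * norm ((x + h) - x)"
    proof (rule differentiable_bound[of UNIV])
      fix y
      show "(?K k has_derivative (\<lambda>c. c *\<^sub>R ?K' k y)) (at y)"
        using packet_integrand_has_vector_derivative[of W t k y] by (simp add: has_vector_derivative_def)
      have "norm (?K' k y) \<le> b k"
        unfolding b_def by (rule norm_packet_integrand_le)
      then show "onorm (\<lambda>c. c *\<^sub>R ?K' k y) \<le> b k"
        by (intro onorm_le) (simp add: mult.commute mult_left_mono)
    qed auto
    then show ?thesis
      by (cases "h = 0") (auto simp: q_def divide_simps mult.commute b_def)
  qed
  have lim: "((\<lambda>h. LINT k|lborel. q h k) \<longlongrightarrow> packet (\<partial>\<^sub>x W) t x) (at 0)"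
    unfolding tendsto_at_iff_sequentially comp_def packet_def
  proof (intro allI impI)
    fix X :: "nat \<Rightarrow> real"
    assume X: "\<forall>i. X i \<in> UNIV - {0}" "X \<longlonglongrightarrow> 0"
    show "(\<lambda>i. LINT k|lborel. q (X i) k) \<longlonglongrightarrow> (LINT k|lborel. ?K' k x)"
    proof (rule integral_dominated_convergence[OF _ _ b_int])
      show "AE k in lborel. (\<lambda>i. q (X i) k) \<longlonglongrightarrow> ?K' k x"
      proof (rule AE_I2)
        fix k
        have "((\<lambda>h. q h k) \<longlongrightarrow> ?K' k x) (at 0)"
          using packet_integrand_has_vector_derivative[of W t k x]
          unfolding q_def has_vector_derivative_iff_quotient .
        then show "(\<lambda>i. q (X i) k) \<longlonglongrightarrow> ?K' k x"
          using X by (auto simp: tendsto_at_iff_sequentially comp_def)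
      qed
    qed (use q_le int q_int in auto)
  qed
  then show ?thesis
    unfolding q_eq has_vector_derivative_iff_quotient .
qed

text \<open>\<open>D \<Phi>(+0) = D' \<Phi>(-0)\<close> for a single matrix element \<open>F\<close> of \<open>\<Phi>\<close> given on the two
  half-lines by the plane-wave expressions \<open>W Pos\<close> and \<open>W Neg\<close>.\<close>

definition boundary_condition ::
  "('n::finite waves \<Rightarrow> 'n waves) \<Rightarrow> ('n waves \<Rightarrow> 'n waves) \<Rightarrow> (real \<Rightarrow> real \<Rightarrow> complex^'n)
    \<Rightarrow> (sign \<Rightarrow> 'n waves) \<Rightarrow> bool" where
  "boundary_condition D D' F W \<longleftrightarrow>
     (\<forall>t. (\<forall>x>0. F t x = packet (W Pos) t x) \<and> (\<forall>x<0. F t x = packet (W Neg) t x) \<and>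
       (\<exists>L. ((\<lambda>x. packet (D (W Pos)) t x) \<longlongrightarrow> L) (at_right 0) \<and>
            ((\<lambda>x. packet (D' (W Neg)) t x) \<longlongrightarrow> L) (at_left 0)))"

text \<open>The boundary condition in mean value: \<open>Phi t x \<phi> \<psi>\<close> stands for the matrix element
  \<open>\<langle>\<phi>, \<Phi>(t,x) \<psi>\<rangle>\<close> and \<open>Dom\<close> for the finite particle domain.\<close>

definition field_boundary_condition ::
  "(real \<Rightarrow> real \<Rightarrow> 'h \<Rightarrow> 'h \<Rightarrow> complex^'n) \<Rightarrow> 'h set \<Rightarrow> ('h \<Rightarrow> 'h \<Rightarrow> sign \<Rightarrow> 'n::finite waves)
    \<Rightarrow> ('n waves \<Rightarrow> 'n waves) \<Rightarrow> ('n waves \<Rightarrow> 'n waves) \<Rightarrow> bool" where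
  "field_boundary_condition Phi Dom W D D' \<longleftrightarrow>
     (\<forall>\<phi>\<in>Dom. \<forall>\<psi>\<in>Dom. boundary_condition D D' (\<lambda>t x. Phi t x \<phi> \<psi>) (W \<phi> \<psi>))"

end

(* At x = 0 both plane waves equal 1, so by dominated convergence the one-sided limits of a packet are
   the integrals of the sum of the two amplitudes.  Every matrix involved is diagonal, so a boundary
   condition reduces, component by component, to one scalar identity per incoming side.  Writing
   r = (1 - \<omega>\<^sup>2) / (1 + \<omega>\<^sup>2), the factors f and g are chosen so that f(-k) \<rho>\<^sub>+(-k) = r f(k),
   g(-k) \<rho>\<^sub>-(-k) = \<epsilon>\<^sub>- r g(k), g \<tau>\<^sub>- = 2 \<omega> f / (1 + \<omega>\<^sup>2) and f \<tau>\<^sub>+ = 2 \<omega> g / (1 + \<omega>\<^sup>2); A, B and C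
   cancel, leaving polynomial identities in \<omega>\<^sup>2, \<epsilon>\<^sub>-, the entries of E and i a k. *)

theory Submission
  imports Defs
begin

section \<open>One-sided limits of packets at the defect\<close>

lemma packet_tendsto_0:
  assumes "converges W"
  shows "((\<lambda>x. packet W t x) \<longlongrightarrow> packet W t 0) (at 0 within S)"
  unfolding tendsto_at_iff_sequentially comp_def packet_def
proof (intro allI impI)
  fix X :: "nat \<Rightarrow> real"
  assume X: "\<forall>i. X i \<in> S - {0}" "X \<longlonglongrightarrow> 0"
  \<comment> \<open>The exponentials have modulus one and \<open>1 / (2 * pi) < 1\<close>, so this
    majorant is uniform in \<open>x\<close> and \<open>t\<close>.\<close>
  let ?b = "\<lambda>k. norm (fst (W k)) + norm (snd (W k))"
  show "(\<lambda>i. LINT k|lborel. packet_integrand W t k (X i)) \<longlonglongrightarrow> (LINT k|lborel. packet_integrand W t k 0)"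
  proof (rule integral_dominated_convergence[where w = ?b])
    show "integrable lborel ?b"
      using assms by (auto simp: converges_def)
    show "AE k in lborel. (\<lambda>i. packet_integrand W t k (X i)) \<longlonglongrightarrow> packet_integrand W t k 0"
      using X(2) isCont_tendsto_compose[OF has_vector_derivative_continuous[OF
            packet_integrand_has_vector_derivative]] by blast
  qed (use integrable_packet_integrand[OF assms] in \<open>auto intro: norm_packet_integrand_le\<close>)
qed

lemma packet_0: "packet W t 0 = (LINT k|lborel. (cis (- (k\<^sup>2 * t)) / (2 * pi)) *s (fst (W k) + snd (W k)))"
  by (simp add: packet_def packet_integrand_def)

text \<open>At \<open>x = 0\<close> a packet sees only the sum of its two amplitudes. Equality of
  these sums for each \<open>k\<close> therefore turns both one-sided limits into the same integral,
  at all times at once.\<close>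

lemma boundary_conditionI:
  assumes "\<And>t x. x > 0 \<Longrightarrow> F t x = packet (W Pos) t x" "\<And>t x. x < 0 \<Longrightarrow> F t x = packet (W Neg) t x"
    and conv: "converges (D (W Pos))" "converges (D' (W Neg))"
    and sums: "\<And>k. fst (D (W Pos) k) + snd (D (W Pos) k) = fst (D' (W Neg) k) + snd (D' (W Neg) k)"
  shows "boundary_condition D D' F W"
proof -
  have "packet (D (W Pos)) t 0 = packet (D' (W Neg)) t 0" for t
    by (simp only: packet_0 sums)
  then show ?thesis
    unfolding boundary_condition_def using assms(1,2) packet_tendsto_0[OF conv(1)] packet_tendsto_0[OF conv(2)]
    by metis
qed

section \<open>Convergence of operator expressions\<close>

lemma converges_add: "converges V \<Longrightarrow> converges W \<Longrightarrow> converges (V + W)"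
  by (simp add: converges_def)

lemma converges_diff: "converges V \<Longrightarrow> converges W \<Longrightarrow> converges (V - W)"
  by (simp add: converges_def)

text \<open>A constant matrix acts as a bounded real-linear map, at \<open>k\<close> and
  \<open>- k\<close> alike. A symbol that varies with \<open>k\<close> may be unbounded, so for such
  operators convergence has to come from the decay hypothesis.\<close>

lemma converges_const_mat_op:
  assumes "converges V"
  shows "converges (\<lblot>M\<rblot> V)"
proof -
  have "bounded_linear ((*v) M)"
    unfolding linear_conv_bounded_linear[symmetric]
    by (rule linearI) (simp_all add: vec_eq_iff matrix_vector_mult_def distrib_left sum.distrib
        scaleR_sum_right)
  then show ?thesis
    using assms by (auto simp: converges_def Dmat_def intro: integrable_bounded_linear)
qed

lemma converges_const_op: "converges V \<Longrightarrow> converges (\<langle>c\<rangle> V)"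
  unfolding Dscal_def by (rule converges_const_mat_op)

lemmas converges_intros = converges_add converges_diff converges_const_op converges_const_mat_op

lemma Dscal_apply: "D\<^sub>s c V = (\<lambda>k. (c k *s fst (V k), c (- k) *s snd (V k)))"
  by (simp add: Dscal_def Dmat_def mat_mult_vec)

lemma Dscal_add: "D\<^sub>s c (V + W) = D\<^sub>s c V + D\<^sub>s c W"
  by (rule ext) (simp add: Dscal_apply vector_add_ldistrib)

lemma Dscal_commute: "D\<^sub>s c (D\<^sub>s d V) = D\<^sub>s d (D\<^sub>s c V)"
  by (simp add: Dscal_apply mult.commute)

section \<open>Diagonal matrices and matching component by component\<close>

lemma diagonal_mult_vec:
  assumes "diagonal_mat M"
  shows "(M *v z) $ i = M $ i $ i * z $ i"
proof -
  have "(M *v z) $ i = (\<Sum>j\<in>UNIV. if j = i then M $ i $ i * z $ i else 0)"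
    unfolding matrix_vector_mult_def vec_lambda_beta
    by (rule sum.cong) (use assms in \<open>auto simp: diagonal_mat_def\<close>)
  then show ?thesis
    by simp
qed

lemma diagonal_mat_intros:
  "diagonal_mat (mat c)" "diagonal_mat M \<Longrightarrow> diagonal_mat (c *\<^sub>m M)"
  "diagonal_mat M \<Longrightarrow> diagonal_mat N \<Longrightarrow> diagonal_mat (M + N)"
  "diagonal_mat M \<Longrightarrow> diagonal_mat N \<Longrightarrow> diagonal_mat (M - N)"
  by (auto simp: diagonal_mat_def mat_def smult_mat_def)

text \<open>The operator is \<open>D\<^sub>A\<close> for the diagonal matrix-valued function \<open>A\<close> with entries \<open>c k i\<close>.\<close>

definition acts_by :: "('n::finite waves \<Rightarrow> 'n waves) \<Rightarrow> (real \<Rightarrow> 'n \<Rightarrow> complex) \<Rightarrow> bool" where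
  "acts_by D c \<longleftrightarrow> (\<forall>V k i. fst (D V k) $ i = c k i * fst (V k) $ i \<and>
                            snd (D V k) $ i = c (- k) i * snd (V k) $ i)"

text \<open>Waves of family \<open>Pos\<close> have k < 0 and arrive from x > 0, those of
  \<open>Neg\<close> have k > 0 and arrive from x < 0, so for each \<open>k\<close> at most one
  packet survives. The arrival side carries the incident and the reflected wave, the other side the
  transmitted one; \<open>neg\<close> balances them for \<open>chi Pos\<close>, \<open>pos\<close>
  for \<open>chi Neg\<close>.\<close>

lemma amplitude_sums_eq:
  fixes chi :: "sign \<Rightarrow> real \<Rightarrow> complex^'n"
  assumes diag: "\<And>s k. diagonal_mat (R s k)" "\<And>s k. diagonal_mat (T s k)"
    and D: "acts_by D c" "acts_by D' d"
    and neg: "\<And>k i. c k i + c (- k) i * R Pos (- k) $ i $ i = d k i * T Neg k $ i $ i"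
    and pos: "\<And>k i. c k i * T Pos k $ i $ i = d k i + d (- k) i * R Neg (- k) $ i $ i"
  defines "W \<equiv> half_line_waves R T chi"
  shows "fst (D (W Pos) k) + snd (D (W Pos) k) = fst (D' (W Neg) k) + snd (D' (W Neg) k)"
proof -
  note simps = D[unfolded acts_by_def] W_def half_line_waves_def amplitudes_def heaviside_def
    smult_mat_simps diagonal_mult_vec[OF diag(1)] diagonal_mult_vec[OF diag(2)]
  consider "k < 0" | "k = 0" | "k > 0"
    by linarith
  then show ?thesis
  proof cases
    case 1
    have "(fst (D (W Pos) k) + snd (D (W Pos) k)) $ i
        = (c k i + c (- k) i * R Pos (- k) $ i $ i) * chi Pos k $ i" for i
      using 1 by (simp add: simps distrib_right)
    moreover have "(fst (D' (W Neg) k) + snd (D' (W Neg) k)) $ i = d k i * T Neg k $ i $ i * chi Pos k $ i" for i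
      using 1 by (simp add: simps)
    ultimately show ?thesis
      by (simp add: vec_eq_iff neg)
  next
    \<comment> \<open>\<open>heaviside 0 = 0\<close>, so every amplitude vanishes here.\<close>
    case 2
    then show ?thesis
      by (simp add: vec_eq_iff simps)
  next
    case 3
    have "(fst (D' (W Neg) k) + snd (D' (W Neg) k)) $ i
        = (d k i + d (- k) i * R Neg (- k) $ i $ i) * chi Neg k $ i" for i
      using 3 by (simp add: simps distrib_right)
    moreover have "(fst (D (W Pos) k) + snd (D (W Pos) k)) $ i = c k i * T Pos k $ i $ i * chi Neg k $ i" for i
      using 3 by (simp add: simps)
    ultimately show ?thesis
      by (simp add: vec_eq_iff pos[symmetric])
  qed
qed

section \<open>Cayley factors of real functions\<close>

lemma of_real_neq_imaginary [simp]: "complex_of_real x + \<i> \<noteq> 0" "complex_of_real x \<noteq> \<i>"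
  by (simp_all add: complex_eq_iff)

text \<open>Here and in \<open>inverse_Cayley_minus\<close>, the left-hand side is the shape a
  factor of \<open>\<rho>\<close> takes at \<open>- k\<close> after the oddness of \<open>A\<close>
  and \<open>C\<close> is applied: reversing \<open>k\<close> inverts the factor.\<close>

lemma Cayley_minus: "(- complex_of_real x - \<i>) / (\<i> - x) = (x + \<i>) / (x - \<i>)"
  by (subst frac_eq_eq) (auto simp: complex_eq_iff)

lemma inverse_Cayley_minus: "(\<i> - complex_of_real x) / (- x - \<i>) = (x - \<i>) / (x + \<i>)"
  by (subst frac_eq_eq) (auto simp: complex_eq_iff)

text \<open>Of the three factors of \<open>f\<close> or \<open>g\<close>, a reflection or
  transmission coefficient conjugates two. The bystander \<open>b\<close> is the
  \<open>B\<close>-factor for \<open>\<rho>\<close> and the \<open>A\<close>-factor for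
  \<open>\<tau>\<close>.\<close>

lemma mult_cancel_two_divisors:
  fixes x y x' y' b r :: "'a::field"
  assumes "x \<noteq> 0" "y \<noteq> 0"
  shows "x * b * y * (x' / x * (y' / y) * r) = x' * b * y' * r"
  using assms by simp

text \<open>The hypotheses of the theorem as a common context for its three cases.
  \<open>decay m\<close> covers, up to \<open>m\<close> derivatives, the operator strings from which
  both sides of every boundary condition are built with constant coefficients.\<close>

locale defect =
  fixes E :: "complex^'n^'n" and A B C \<omega> :: "real \<Rightarrow> real"
    and \<epsilon> :: "sign \<Rightarrow> real" and \<rho> \<tau> :: "sign \<Rightarrow> real \<Rightarrow> complex" and f g :: "real \<Rightarrow> complex"
    and R T :: "sign \<Rightarrow> real \<Rightarrow> complex^'n^'n"
    and Phi :: "real \<Rightarrow> real \<Rightarrow> 'h \<Rightarrow> 'h \<Rightarrow> complex^'n" and Dom :: "'h set"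
    and chi :: "'h \<Rightarrow> 'h \<Rightarrow> sign \<Rightarrow> real \<Rightarrow> complex^'n"
    and W :: "'h \<Rightarrow> 'h \<Rightarrow> sign \<Rightarrow> 'n waves"
    and e :: real and Df Dg Dw :: "'n waves \<Rightarrow> 'n waves" and P Q :: "complex^'n^'n"
    and decay :: "nat \<Rightarrow> bool"
  assumes E: "diagonal_mat E" "E ** E = mat 1"
    and eps: "\<epsilon> Pos = 1" "\<epsilon> Neg \<in> {1, -1}" "e = \<epsilon> Neg"
    and parity: "\<And>k. A (- k) = - A k" "\<And>k. B (- k) = B k" "\<And>k. C (- k) = - C k"
      "\<And>k. \<omega> (- k) = - e * \<omega> k"
    and rho: "\<And>s k. \<rho> s k = \<epsilon> s * ((A k - \<i>) / (A k + \<i>)) * ((C k - sg s * \<i>) / (C k + sg s * \<i>))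
                * ((1 - (\<omega> k)\<^sup>2) / (1 + (\<omega> k)\<^sup>2))"
    and tau: "\<And>s k. \<tau> s k = ((B k - sg s * \<i>) / (B k + sg s * \<i>)) * ((C k - sg s * \<i>) / (C k + sg s * \<i>))
                * (2 * \<omega> k / (1 + (\<omega> k)\<^sup>2))"
    and f: "\<And>k. f k = (A k + \<i>) * (B k + \<i>) * (C k + \<i>)"
    and g: "\<And>k. g k = (A k + \<i>) * (B k - \<i>) * (C k - \<i>)"
    and Phi: "\<And>\<phi> \<psi> t x. \<phi> \<in> Dom \<Longrightarrow> \<psi> \<in> Dom \<Longrightarrow> x \<noteq> 0 \<Longrightarrow>
                Phi t x \<phi> \<psi> = matrix_element_form R T (chi \<phi> \<psi>) t x"
    and W: "\<And>\<phi> \<psi>. W \<phi> \<psi> = half_line_waves R T (chi \<phi> \<psi>)"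
    and ops: "Df = D\<^sub>s f" "Dg = D\<^sub>s g" "Dw = D\<^sub>s (\<lambda>k. \<omega> k)"
    and PQ: "P = (1/2) *\<^sub>m (mat 1 + e *\<^sub>m E)" "Q = (1/2) *\<^sub>m (mat 1 - e *\<^sub>m E)"
    and decay: "\<And>m. decay m \<longleftrightarrow> (\<forall>\<phi>\<in>Dom. \<forall>\<psi>\<in>Dom. converges (W \<phi> \<psi> Pos) \<and> converges (W \<phi> \<psi> Neg) \<and>
       (\<forall>j\<le>m. converges ((Df \<cdot> Dw \<cdot> \<partial>\<^sub>x ^^ j) (W \<phi> \<psi> Pos)) \<and>
              converges ((Dg \<cdot> \<partial>\<^sub>x ^^ j) (W \<phi> \<psi> Neg)) \<and>
              converges ((Dw \<cdot> Dw \<cdot> Dg \<cdot> \<partial>\<^sub>x ^^ j) (W \<phi> \<psi> Neg))))"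
begin

section \<open>Scalar reflection and transmission identities\<close>

definition w :: "real \<Rightarrow> complex" where "w k = complex_of_real ((\<omega> k)\<^sup>2)"

lemma e_cases: "e = 1 \<or> e = - 1"
  using eps by auto

text \<open>Squaring removes the sign \<open>- e\<close> from the parity of \<open>\<omega>\<close>,
  so \<open>w\<close> is even in both cases.\<close>

lemma w_minus [simp]: "w (- k) = w k" for k
  using e_cases by (auto simp: w_def parity)

lemma one_plus_w [simp]: "1 + w k \<noteq> 0" for k
proof -
  have "1 + (\<omega> k)\<^sup>2 \<noteq> 0"
    by (smt (verit) zero_le_power2)
  then show ?thesis
    unfolding w_def by (metis of_real_1 of_real_add of_real_eq_0_iff)
qed

lemma reflection_Pos: "f (- k) * \<omega> (- k) * \<rho> Pos (- k) = - e * f k * \<omega> k * (1 - w k) / (1 + w k)" for k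
proof -
  \<comment> \<open>\<open>A\<close> and \<open>C\<close> are both odd, so their two sign changes
    cancel in the product.\<close>
  have "f (- k) = (A k - \<i>) * (B k + \<i>) * (C k - \<i>)"
    by (simp add: f parity algebra_simps)
  moreover have "\<rho> Pos (- k) = (A k + \<i>) / (A k - \<i>) * ((C k + \<i>) / (C k - \<i>)) * ((1 - w k) / (1 + w k))"
    using w_minus[of k] by (simp add: rho eps parity Cayley_minus inverse_Cayley_minus w_def)
  ultimately have "f (- k) * \<rho> Pos (- k) = f k * ((1 - w k) / (1 + w k))"
    by (simp only: f) (rule mult_cancel_two_divisors; simp)
  then have "\<omega> (- k) * (f (- k) * \<rho> Pos (- k)) = - e * \<omega> k * (f k * ((1 - w k) / (1 + w k)))"
    by (simp add: parity)
  then show ?thesis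
    by (simp add: mult_ac)
qed

text \<open>The sign \<open>e\<close> comes from \<open>\<epsilon> Neg\<close> inside
  \<open>\<rho>\<close>, whereas in \<open>reflection_Pos\<close> the sign \<open>- e\<close> comes
  from the parity of \<open>\<omega>\<close>. No \<open>\<omega>\<close> is carried along here
  because the left half-line operators contain \<open>Dw\<close> only in even powers.\<close>

lemma reflection_Neg: "g (- k) * \<rho> Neg (- k) = e * g k * (1 - w k) / (1 + w k)" for k
proof -
  have "g (- k) = (A k - \<i>) * (B k - \<i>) * (C k + \<i>)"
    by (simp add: g parity algebra_simps)
  moreover have "\<rho> Neg (- k) = (A k + \<i>) / (A k - \<i>) * ((C k - \<i>) / (C k + \<i>)) * (e * ((1 - w k) / (1 + w k)))"
    using w_minus[of k] by (simp add: rho eps parity Cayley_minus inverse_Cayley_minus w_def)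
  ultimately have "g (- k) * \<rho> Neg (- k) = g k * (e * ((1 - w k) / (1 + w k)))"
    by (simp only: g) (rule mult_cancel_two_divisors; simp)
  then show ?thesis
    by (simp add: mult_ac)
qed

text \<open>Transmission conjugates the \<open>B\<close>- and \<open>C\<close>-factors, which is
  exactly the passage from \<open>f\<close> to \<open>g\<close>; \<open>transmission_Neg\<close> is
  the passage back.\<close>

lemma transmission_Pos: "f k * \<omega> k * \<tau> Pos k = 2 * w k * g k / (1 + w k)" for k
proof -
  have "f k * \<tau> Pos k = (B k + \<i>) * (A k + \<i>) * (C k + \<i>)
      * ((B k - \<i>) / (B k + \<i>) * ((C k - \<i>) / (C k + \<i>)) * (2 * \<omega> k / (1 + w k)))"
    by (simp add: f tau w_def)
  also have "\<dots> = (B k - \<i>) * (A k + \<i>) * (C k - \<i>) * (2 * \<omega> k / (1 + w k))"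
    by (rule mult_cancel_two_divisors) simp_all
  also have "\<dots> = g k * (2 * \<omega> k / (1 + w k))"
    by (simp add: g)
  finally have "\<omega> k * (f k * \<tau> Pos k) = \<omega> k * (g k * (2 * \<omega> k / (1 + w k)))"
    by simp
  then show ?thesis
    by (simp add: w_def power2_eq_square mult_ac)
qed

lemma transmission_Neg: "g k * \<tau> Neg k = f k * \<omega> k * 2 / (1 + w k)" for k
proof -
  have "g k * \<tau> Neg k = (B k - \<i>) * (A k + \<i>) * (C k - \<i>)
      * ((B k + \<i>) / (B k - \<i>) * ((C k + \<i>) / (C k - \<i>)) * (2 * \<omega> k / (1 + w k)))"
    by (simp add: g tau w_def)
  also have "\<dots> = (B k + \<i>) * (A k + \<i>) * (C k + \<i>) * (2 * \<omega> k / (1 + w k))"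
    by (rule mult_cancel_two_divisors) simp_all
  finally show ?thesis
    by (simp add: f)
qed

text \<open>Isolates what differs between the three cases: the matrix part \<open>K\<close> of the
  scattering data and the factors \<open>p\<close>, \<open>q\<close> of the two operators beyond
  \<open>f k * \<omega> k\<close> and \<open>g k\<close>. Dividing the matching conditions by
  \<open>f k * \<omega> k / (1 + w k)\<close> and by \<open>g k / (1 + w k)\<close> respectively
  leaves \<open>neg\<close> and \<open>pos\<close>, free of \<open>A\<close>, \<open>B\<close> and
  \<open>C\<close>.\<close>

lemma field_boundary_condition_if_balanced: "field_boundary_condition Phi Dom W D D'"
  if R: "\<And>s k. R s k = \<rho> s k *\<^sub>m K s k" "\<And>s k. T s k = \<tau> s k *\<^sub>m K s k"
    and K: "\<And>s k. diagonal_mat (K s k)"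
    and D: "acts_by D (\<lambda>k i. f k * \<omega> k * p k)" "acts_by D' (\<lambda>k i. g k * q k i)"
    and conv: "\<And>\<phi> \<psi>. \<phi> \<in> Dom \<Longrightarrow> \<psi> \<in> Dom \<Longrightarrow> converges (D (W \<phi> \<psi> Pos)) \<and> converges (D' (W \<phi> \<psi> Neg))"
    and neg: "\<And>k i. (1 + w k) * p k - e * (1 - w k) * p (- k) * K Pos (- k) $ i $ i
                       = 2 * q k i * K Neg k $ i $ i"
    and pos: "\<And>k i. 2 * w k * p k * K Pos k $ i $ i
                       = (1 + w k) * q k i + e * (1 - w k) * q (- k) i * K Neg (- k) $ i $ i"
  for D D' K p q
proof -
  \<comment> \<open>Matching for packets arriving from x > 0.\<close>
  have *: "f k * \<omega> k * p k + f (- k) * \<omega> (- k) * p (- k) * R Pos (- k) $ i $ i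
      = g k * q k i * T Neg k $ i $ i" for k i
  proof -
    have "f k * \<omega> k * p k + f (- k) * \<omega> (- k) * p (- k) * R Pos (- k) $ i $ i
      = f k * \<omega> k * p k + (f (- k) * \<omega> (- k) * \<rho> Pos (- k)) * p (- k) * K Pos (- k) $ i $ i"
      by (simp add: R smult_mat_def mult_ac)
    also have "\<dots> = f k * \<omega> k / (1 + w k) *
        ((1 + w k) * p k - e * (1 - w k) * p (- k) * K Pos (- k) $ i $ i)"
      unfolding reflection_Pos by (simp add: field_simps)
    also have "\<dots> = (g k * \<tau> Neg k) * q k i * K Neg k $ i $ i"
      unfolding neg transmission_Neg by (simp add: field_simps)
    finally show ?thesis
      by (simp add: R smult_mat_def mult_ac)
  qed
  \<comment> \<open>Matching for packets arriving from x < 0.\<close>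
  have **: "f k * \<omega> k * p k * T Pos k $ i $ i
      = g k * q k i + g (- k) * q (- k) i * R Neg (- k) $ i $ i" for k i
  proof -
    have "f k * \<omega> k * p k * T Pos k $ i $ i = (f k * \<omega> k * \<tau> Pos k) * p k * K Pos k $ i $ i"
      by (simp add: R smult_mat_def mult_ac)
    also have "\<dots> = g k / (1 + w k) * (2 * w k * p k * K Pos k $ i $ i)"
      unfolding transmission_Pos by (simp add: field_simps)
    also have "\<dots> = g k * q k i + (g (- k) * \<rho> Neg (- k)) * q (- k) i * K Neg (- k) $ i $ i"
      unfolding pos reflection_Neg by (simp add: field_simps)
    finally show ?thesis
      by (simp add: R smult_mat_def mult_ac)
  qed
  have diag: "diagonal_mat (R s k)" "diagonal_mat (T s k)" for s k
    by (simp_all add: R K diagonal_mat_intros)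
  show ?thesis
    unfolding field_boundary_condition_def
  proof (intro ballI boundary_conditionI)
    fix \<phi> \<psi> assume dom: "\<phi> \<in> Dom" "\<psi> \<in> Dom"
    show "Phi t x \<phi> \<psi> = packet (W \<phi> \<psi> Pos) t x" if "x > 0" for t x
      using that Phi[OF dom] matrix_element_form_eq_packet[of Pos x] by (simp add: W)
    show "Phi t x \<phi> \<psi> = packet (W \<phi> \<psi> Neg) t x" if "x < 0" for t x
      using that Phi[OF dom] matrix_element_form_eq_packet[of Neg x] by (simp add: W)
    show "fst (D (W \<phi> \<psi> Pos) k) + snd (D (W \<phi> \<psi> Pos) k)
        = fst (D' (W \<phi> \<psi> Neg) k) + snd (D' (W \<phi> \<psi> Neg) k)" for k
      unfolding W by (rule amplitude_sums_eq[OF diag D * **])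
  qed (use conv in blast)+
qed

section \<open>Eigenvalues of \<open>E\<close>, its projectors, and convergence by order of
  derivative\<close>

lemma E_entry: "E $ i $ i = 1 \<or> E $ i $ i = - 1" for i
proof -
  have "(E *v (E *v axis i 1)) $ i = axis i 1 $ i"
    by (simp add: matrix_vector_mul_assoc E)
  then have "E $ i $ i * E $ i $ i = 1"
    by (simp add: diagonal_mult_vec[OF E(1)] axis_def)
  then show ?thesis
    by (simp add: square_eq_1_iff)
qed

text \<open>As \<open>E\<close> squares to the identity, \<open>P\<close> and \<open>Q\<close> are
  the projectors onto its eigenspaces for \<open>e\<close> and \<open>- e\<close>.\<close>

lemma PQ_diag: "diagonal_mat P" "diagonal_mat Q"
  unfolding PQ by (intro diagonal_mat_intros E)+

lemma PQ_entry: "P $ i $ i = (1 + e * E $ i $ i) / 2" "Q $ i $ i = (1 - e * E $ i $ i) / 2" for i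
  by (simp_all add: PQ smult_mat_def mat_def)

lemmas acts_by_simps = acts_by_def ops Dscal_apply Dmat_def deriv_x_apply diagonal_mult_vec[OF PQ_diag(1)]
  diagonal_mult_vec[OF PQ_diag(2)] PQ_entry parity w_def

lemma decay_converges: "converges ((Df \<cdot> Dw \<cdot> \<partial>\<^sub>x ^^ j) (W \<phi> \<psi> Pos))"
    "converges ((Dg \<cdot> \<partial>\<^sub>x ^^ j) (W \<phi> \<psi> Neg))"
    "converges ((Dw \<cdot> Dw \<cdot> Dg \<cdot> \<partial>\<^sub>x ^^ j) (W \<phi> \<psi> Neg))"
  if "decay m" "j \<le> m" "\<phi> \<in> Dom" "\<psi> \<in> Dom" for m j \<phi> \<psi>
  using that unfolding decay by blast+

lemma converges_order_0: "converges (Df (Dw (W \<phi> \<psi> Pos)))" "converges (Dg (W \<phi> \<psi> Neg))"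
    "converges (Dw (Dw (Dg (W \<phi> \<psi> Neg))))"
  if "decay m" "\<phi> \<in> Dom" "\<psi> \<in> Dom" for m \<phi> \<psi>
  using decay_converges[of m 0] that by simp_all

lemma converges_order_1: "converges (Df (Dw (\<partial>\<^sub>x (W \<phi> \<psi> Pos))))" "converges (Dg (\<partial>\<^sub>x (W \<phi> \<psi> Neg)))"
    "converges (Dw (Dw (Dg (\<partial>\<^sub>x (W \<phi> \<psi> Neg)))))"
  if "decay m" "m = 1 \<or> m = 2" "\<phi> \<in> Dom" "\<psi> \<in> Dom" for m \<phi> \<psi>
  using decay_converges[of m 1] that by auto

lemma converges_order_2: "converges (Df (Dw (\<partial>\<^sub>x (\<partial>\<^sub>x (W \<phi> \<psi> Pos)))))" "converges (Dg (\<partial>\<^sub>x (\<partial>\<^sub>x (W \<phi> \<psi> Neg))))"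
    "converges (Dw (Dw (Dg (\<partial>\<^sub>x (\<partial>\<^sub>x (W \<phi> \<psi> Neg))))))"
  if "decay 2" "\<phi> \<in> Dom" "\<psi> \<in> Dom" for \<phi> \<psi>
  using decay_converges[of 2 2] that by (simp_all add: numeral_2_eq_2)

text \<open>Pulls the coefficients of \<open>1 + a \<partial>\<^sub>x\<close> out to the left, so
  that convergence splits into the strings covered by \<open>decay\<close>.\<close>

lemma Df_Dw_linear: "Df (U + V) = Df U + Df V" "Dw (U + V) = Dw U + Dw V"
    "Df (\<langle>c\<rangle> V) = \<langle>c\<rangle> (Df V)" "Dw (\<langle>c\<rangle> V) = \<langle>c\<rangle> (Dw V)" for U V c
  unfolding ops by (rule Dscal_add Dscal_commute)+

lemmas operator_simps = comp_apply plus_fun_apply minus_apply Df_Dw_linear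

section \<open>The boundary conditions for the three families of matrices\<close>

lemma scalar_matrices: "field_boundary_condition Phi Dom W
        (\<langle>2\<rangle> \<cdot> Df \<cdot> Dw)
        ((\<langle>1 - e\<rangle> + \<langle>1 + e\<rangle> \<cdot> Dw \<cdot> Dw) \<cdot> Dg) \<and>
      field_boundary_condition Phi Dom W
        (\<langle>2\<rangle> \<cdot> Df \<cdot> Dw \<cdot> \<partial>\<^sub>x)
        ((\<langle>1 + e\<rangle> + \<langle>1 - e\<rangle> \<cdot> Dw \<cdot> Dw) \<cdot> Dg \<cdot> \<partial>\<^sub>x)" (is "?A \<and> ?B")
  if "\<forall>s k. R s k = \<rho> s k *\<^sub>m mat 1 \<and> T s k = \<tau> s k *\<^sub>m mat 1" and "decay 1"
proof -
  have R: "R s k = \<rho> s k *\<^sub>m mat 1" "T s k = \<tau> s k *\<^sub>m mat 1" for s k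
    using that(1) by auto
  note field = field_boundary_condition_if_balanced[where K = "\<lambda>_ _. mat 1", OF R diagonal_mat_intros(1)]
  note c = converges_order_0[OF \<open>decay 1\<close>] converges_order_1[OF \<open>decay 1\<close>, simplified]
  \<comment> \<open>With \<open>K\<close> the identity, \<open>neg\<close> forces \<open>q\<close>,
    since (1 + w) - e (1 - w) = (1 - e) + (1 + e) w. Then \<open>pos\<close> holds because the
    product of this with (1 + e) + (1 - e) w is 4 w when e is 1 or -1. Among the subgoals, 1 and 2
    identify the symbols, 3 is convergence, 4 and 5 are \<open>neg\<close> and
    \<open>pos\<close>.\<close>
  have ?A
  proof (rule field[where p = "\<lambda>_. 2" and q = "\<lambda>k i. 1 - e + (1 + e) * w k"], goal_cases)
    case (3 \<phi> \<psi>)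
    then show ?case
      by (simp only: operator_simps) (intro conjI converges_intros c)
  qed (use e_cases in \<open>auto simp: acts_by_simps mat_def algebra_simps power2_eq_square\<close>)
  \<comment> \<open>The symbol \<i> k of the derivative is odd, so it reverses the sign of the
    reflected terms: \<open>neg\<close> and \<open>pos\<close> are those of the first condition with
    e replaced by - e.\<close>
  moreover have ?B
  proof (rule field[where p = "\<lambda>k. 2 * (\<i> * k)" and q = "\<lambda>k i. (1 + e + (1 - e) * w k) * (\<i> * k)"],
      goal_cases)
    case (3 \<phi> \<psi>)
    then show ?case
      by (simp only: operator_simps) (intro conjI converges_intros c)
  qed (use e_cases in \<open>auto simp: acts_by_simps mat_def algebra_simps power2_eq_square\<close>)
  ultimately show ?thesis ..
qed

text \<open>Where the entry of \<open>E\<close> is e, \<open>neg\<close> asks for the factor e w on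
  the left half-line; where it is - e, for the factor - e. The projectors \<open>P\<close> and
  \<open>Q\<close> assemble the two answers into one operator.\<close>

lemma diagonal_matrices: "field_boundary_condition Phi Dom W
        (Df \<cdot> Dw)
        (\<langle>e\<rangle> \<cdot> (\<lblot>P\<rblot> \<cdot> Dw \<cdot> Dw - \<lblot>Q\<rblot>) \<cdot> Dg) \<and>
      field_boundary_condition Phi Dom W
        (Df \<cdot> Dw \<cdot> \<partial>\<^sub>x)
        (\<langle>e\<rangle> \<cdot> (\<lblot>P\<rblot> - \<lblot>Q\<rblot> \<cdot> Dw \<cdot> Dw) \<cdot> Dg \<cdot> \<partial>\<^sub>x)" (is "?A \<and> ?B")
  if "\<forall>s k. R s k = \<rho> s k *\<^sub>m E \<and> T s k = \<tau> s k *\<^sub>m E" and "decay 1"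
proof -
  have R: "R s k = \<rho> s k *\<^sub>m E" "T s k = \<tau> s k *\<^sub>m E" for s k
    using that(1) by auto
  note field = field_boundary_condition_if_balanced[where K = "\<lambda>_ _. E", OF R E(1)]
  note c = converges_order_0[OF \<open>decay 1\<close>] converges_order_1[OF \<open>decay 1\<close>, simplified]
  \<comment> \<open>These are the diagonal entries of \<open>P\<close> and \<open>Q\<close>, not the
    factors \<open>p\<close> and \<open>q\<close> of the criterion.\<close>
  define p where "p i = (1 + e * E $ i $ i) / 2" for i
  define q where "q i = (1 - e * E $ i $ i) / 2" for i
  note pq = p_def[symmetric] q_def[symmetric]
  have pq_cases: "p i = 0 \<and> q i = 1 \<and> E $ i $ i = - e \<or> p i = 1 \<and> q i = 0 \<and> E $ i $ i = e" for i
    using e_cases E_entry[of i] by (auto simp: p_def q_def)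
  have ?A
  proof (rule field[where p = "\<lambda>_. 1" and q = "\<lambda>k i. e * (p i * w k - q i)"], goal_cases)
    case (3 \<phi> \<psi>)
    then show ?case
      by (simp only: operator_simps) (intro conjI converges_intros c)
  next
    case (4 k i)
    show ?case
      using e_cases pq_cases[of i] by (auto simp: algebra_simps)
  next
    case (5 k i)
    show ?case
      using e_cases pq_cases[of i] by (auto simp: algebra_simps)
  qed (use e_cases in \<open>auto simp: acts_by_simps pq algebra_simps power2_eq_square\<close>)
  \<comment> \<open>Replacing e by - e interchanges \<open>P\<close> and \<open>Q\<close>, which
    moves \<open>w\<close> from the first projector to the second.\<close>
  moreover have ?B
  proof (rule field[where p = "\<lambda>k. \<i> * k" and q = "\<lambda>k i. e * (p i - q i * w k) * (\<i> * k)"],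
      goal_cases)
    case (3 \<phi> \<psi>)
    then show ?case
      by (simp only: operator_simps) (intro conjI converges_intros c)
  next
    case (4 k i)
    show ?case
      using e_cases pq_cases[of i] by (auto simp: algebra_simps)
  next
    case (5 k i)
    show ?case
      using e_cases pq_cases[of i] by (auto simp: algebra_simps)
  qed (use e_cases in \<open>auto simp: acts_by_simps pq algebra_simps power2_eq_square\<close>)
  ultimately show ?thesis ..
qed

text \<open>Let z be the symbol of \<open>a \<partial>\<^sub>x\<close>. Where the entry of
  \<open>E\<close> is 1, \<open>K\<close> is 1, and the even and odd parts of 1 + z are matched as
  in the two scalar conditions. Where it is -1, \<open>K\<close> is (1 - z) / (1 + z) or its
  inverse, and the scalar factor merely acquires 1 - z on the left. Both are captured by the one
  expression with \<open>P\<close> and \<open>Q\<close>.\<close>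

lemma mixed_matrices: "field_boundary_condition Phi Dom W
        (Df \<cdot> Dw \<cdot> (\<langle>1\<rangle> + \<langle>a\<rangle> \<cdot> \<partial>\<^sub>x))
        ((\<langle>(1 - e) / 2\<rangle> + \<langle>(1 + e) / 2\<rangle> \<cdot> Dw \<cdot> Dw) \<cdot> Dg
           + \<langle>a * e\<rangle> \<cdot> (\<lblot>P\<rblot> - \<lblot>Q\<rblot> \<cdot> Dw \<cdot> Dw) \<cdot> Dg \<cdot> \<partial>\<^sub>x) \<and>
      field_boundary_condition Phi Dom W
        (Df \<cdot> Dw \<cdot> (\<langle>1\<rangle> + \<langle>a\<rangle> \<cdot> \<partial>\<^sub>x) \<cdot> \<partial>\<^sub>x)
        ((\<langle>(1 + e) / 2\<rangle> + \<langle>(1 - e) / 2\<rangle> \<cdot> Dw \<cdot> Dw) \<cdot> Dg \<cdot> \<partial>\<^sub>x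
           - \<langle>a * e\<rangle> \<cdot> (\<lblot>Q\<rblot> - \<lblot>P\<rblot> \<cdot> Dw \<cdot> Dw) \<cdot> Dg \<cdot> \<partial>\<^sub>x \<cdot> \<partial>\<^sub>x)" (is "?A \<and> ?B")
  if "\<forall>s k. R s k = (\<rho> s k / (1 + sg s * \<i> * a * k)) *\<^sub>m (mat 1 + (sg s * \<i> * a * k) *\<^sub>m E) \<and>
           T s k = (\<tau> s k / (1 + sg s * \<i> * a * k)) *\<^sub>m (mat 1 + (sg s * \<i> * a * k) *\<^sub>m E)"
    and "decay 2"
proof -
  define K where
    "K s k = (1 / (1 + sg s * \<i> * a * k)) *\<^sub>m (mat 1 + (sg s * \<i> * a * k) *\<^sub>m E)" for s and k :: real
  have R: "R s k = \<rho> s k *\<^sub>m K s k" "T s k = \<tau> s k *\<^sub>m K s k" for s k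
    unfolding that(1)[rule_format, THEN conjunct1] that(1)[rule_format, THEN conjunct2]
    by (simp_all add: K_def smult_mat_simps(2))
  have K: "diagonal_mat (K s k)" for s k
    unfolding K_def by (intro diagonal_mat_intros E)
  note field = field_boundary_condition_if_balanced[OF R K]
  note c = converges_order_0[OF \<open>decay 2\<close>] converges_order_1[OF \<open>decay 2\<close>, simplified] converges_order_2[OF \<open>decay 2\<close>]
  define p where "p i = (1 + e * E $ i $ i) / 2" for i
  define q where "q i = (1 - e * E $ i $ i) / 2" for i
  define z where "z k = \<i> * a * k" for k :: real
  note pq = p_def[symmetric] q_def[symmetric]
  have pq_cases: "p i = 0 \<and> q i = 1 \<and> E $ i $ i = - e \<or> p i = 1 \<and> q i = 0 \<and> E $ i $ i = e" for i
    using e_cases E_entry[of i] by (auto simp: p_def q_def)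
  \<comment> \<open>\<open>z\<close> is purely imaginary, so the denominators of \<open>K\<close>
    never vanish.\<close>
  have z: "1 + z k \<noteq> 0" "1 - z k \<noteq> 0" "1 \<noteq> z k" "z (- k) = - z k" for k
    by (auto simp: z_def complex_eq_iff)
  have K_entry: "K Pos k $ i $ i = (1 + z k * E $ i $ i) / (1 + z k)"
      "K Neg k $ i $ i = (1 - z k * E $ i $ i) / (1 - z k)" for k i
    by (simp_all add: K_def smult_mat_def mat_def z_def)
  have ?A
  proof (rule field[where p = "\<lambda>k. 1 + z k"
        and q = "\<lambda>k i. (1 - e) / 2 + (1 + e) / 2 * w k + e * (p i - q i * w k) * z k"], goal_cases)
    case (3 \<phi> \<psi>)
    then show ?case
      by (simp only: operator_simps) (intro conjI converges_intros c)
  next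
    case (4 k i)
    show ?case
      using e_cases pq_cases[of i] z[of k] by (auto simp: K_entry) (auto simp: field_simps)
  next
    case (5 k i)
    show ?case
      using e_cases pq_cases[of i] z[of k] by (auto simp: K_entry) (auto simp: field_simps)
  qed (use e_cases in \<open>auto simp: acts_by_simps pq z_def algebra_simps power2_eq_square\<close>)
  \<comment> \<open>The extra odd factor \<i> k again replaces e by - e, turning e (P - Q w) into -
    e (Q - P w).\<close>
  moreover have ?B
  proof (rule field[where p = "\<lambda>k. (1 + z k) * (\<i> * k)"
        and q = "\<lambda>k i. ((1 + e) / 2 + (1 - e) / 2 * w k - e * (q i - p i * w k) * z k) * (\<i> * k)"],
      goal_cases)
    case (3 \<phi> \<psi>)
    then show ?case
      by (simp only: operator_simps) (intro conjI converges_intros c)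
  next
    case (4 k i)
    show ?case
      using e_cases pq_cases[of i] z[of k] by (auto simp: K_entry) (auto simp: field_simps)
  next
    case (5 k i)
    show ?case
      using e_cases pq_cases[of i] z[of k] by (auto simp: K_entry) (auto simp: field_simps)
  qed (use e_cases in \<open>auto simp: acts_by_simps pq z_def algebra_simps power2_eq_square\<close>)
  ultimately show ?thesis ..
qed

end

theorem mainTheorem4:
  fixes E :: "complex^'n^'n" and a :: real and A B C \<omega> :: "real \<Rightarrow> real"
    and \<epsilon> :: "sign \<Rightarrow> real" and \<rho> \<tau> :: "sign \<Rightarrow> real \<Rightarrow> complex" and f g :: "real \<Rightarrow> complex"
    and R T :: "sign \<Rightarrow> real \<Rightarrow> complex^'n^'n"
    and Phi :: "real \<Rightarrow> real \<Rightarrow> 'h \<Rightarrow> 'h \<Rightarrow> complex^'n" and Dom :: "'h set"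
    and chi :: "'h \<Rightarrow> 'h \<Rightarrow> sign \<Rightarrow> real \<Rightarrow> complex^'n"
    and W :: "'h \<Rightarrow> 'h \<Rightarrow> sign \<Rightarrow> 'n waves"
    and e :: real and Df Dg Dw :: "'n waves \<Rightarrow> 'n waves" and P Q :: "complex^'n^'n"
    and decay :: "nat \<Rightarrow> bool"
  assumes E: "diagonal_mat E" "E ** E = mat 1"
    and eps: "\<epsilon> Pos = 1" "\<epsilon> Neg \<in> {1, -1}" "e = \<epsilon> Neg"
    and parity: "\<And>k. A (- k) = - A k" "\<And>k. B (- k) = B k" "\<And>k. C (- k) = - C k"
      "\<And>k. \<omega> (- k) = - e * \<omega> k"
    and rho: "\<And>s k. \<rho> s k = \<epsilon> s * ((A k - \<i>) / (A k + \<i>)) * ((C k - sg s * \<i>) / (C k + sg s * \<i>))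
                * ((1 - (\<omega> k)\<^sup>2) / (1 + (\<omega> k)\<^sup>2))"
    and tau: "\<And>s k. \<tau> s k = ((B k - sg s * \<i>) / (B k + sg s * \<i>)) * ((C k - sg s * \<i>) / (C k + sg s * \<i>))
                * (2 * \<omega> k / (1 + (\<omega> k)\<^sup>2))"
    and f: "\<And>k. f k = (A k + \<i>) * (B k + \<i>) * (C k + \<i>)"
    and g: "\<And>k. g k = (A k + \<i>) * (B k - \<i>) * (C k - \<i>)"
    and Phi: "\<And>\<phi> \<psi> t x. \<phi> \<in> Dom \<Longrightarrow> \<psi> \<in> Dom \<Longrightarrow> x \<noteq> 0 \<Longrightarrow>
                Phi t x \<phi> \<psi> = matrix_element_form R T (chi \<phi> \<psi>) t x"
    and W: "\<And>\<phi> \<psi>. W \<phi> \<psi> = half_line_waves R T (chi \<phi> \<psi>)"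
    and ops: "Df = D\<^sub>s f" "Dg = D\<^sub>s g" "Dw = D\<^sub>s (\<lambda>k. \<omega> k)"
    and PQ: "P = (1/2) *\<^sub>m (mat 1 + e *\<^sub>m E)" "Q = (1/2) *\<^sub>m (mat 1 - e *\<^sub>m E)"
    and decay: "\<And>m. decay m \<longleftrightarrow> (\<forall>\<phi>\<in>Dom. \<forall>\<psi>\<in>Dom. converges (W \<phi> \<psi> Pos) \<and> converges (W \<phi> \<psi> Neg) \<and>
       (\<forall>j\<le>m. converges ((Df \<cdot> Dw \<cdot> \<partial>\<^sub>x ^^ j) (W \<phi> \<psi> Pos)) \<and>
              converges ((Dg \<cdot> \<partial>\<^sub>x ^^ j) (W \<phi> \<psi> Neg)) \<and>
              converges ((Dw \<cdot> Dw \<cdot> Dg \<cdot> \<partial>\<^sub>x ^^ j) (W \<phi> \<psi> Neg))))"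
  shows
    "((\<forall>s k. R s k = \<rho> s k *\<^sub>m mat 1 \<and> T s k = \<tau> s k *\<^sub>m mat 1) \<and> decay 1 \<longrightarrow>
        field_boundary_condition Phi Dom W
          (\<langle>2\<rangle> \<cdot> Df \<cdot> Dw)
          ((\<langle>1 - e\<rangle> + \<langle>1 + e\<rangle> \<cdot> Dw \<cdot> Dw) \<cdot> Dg) \<and>
        field_boundary_condition Phi Dom W
          (\<langle>2\<rangle> \<cdot> Df \<cdot> Dw \<cdot> \<partial>\<^sub>x)
          ((\<langle>1 + e\<rangle> + \<langle>1 - e\<rangle> \<cdot> Dw \<cdot> Dw) \<cdot> Dg \<cdot> \<partial>\<^sub>x)) \<and>
     ((\<forall>s k. R s k = \<rho> s k *\<^sub>m E \<and> T s k = \<tau> s k *\<^sub>m E) \<and> decay 1 \<longrightarrow>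
        field_boundary_condition Phi Dom W
          (Df \<cdot> Dw)
          (\<langle>e\<rangle> \<cdot> (\<lblot>P\<rblot> \<cdot> Dw \<cdot> Dw - \<lblot>Q\<rblot>) \<cdot> Dg) \<and>
        field_boundary_condition Phi Dom W
          (Df \<cdot> Dw \<cdot> \<partial>\<^sub>x)
          (\<langle>e\<rangle> \<cdot> (\<lblot>P\<rblot> - \<lblot>Q\<rblot> \<cdot> Dw \<cdot> Dw) \<cdot> Dg \<cdot> \<partial>\<^sub>x)) \<and>
     ((\<forall>s k. R s k = (\<rho> s k / (1 + sg s * \<i> * a * k)) *\<^sub>m (mat 1 + (sg s * \<i> * a * k) *\<^sub>m E) \<and>
             T s k = (\<tau> s k / (1 + sg s * \<i> * a * k)) *\<^sub>m (mat 1 + (sg s * \<i> * a * k) *\<^sub>m E)) \<and> decay 2 \<longrightarrow>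
        field_boundary_condition Phi Dom W
          (Df \<cdot> Dw \<cdot> (\<langle>1\<rangle> + \<langle>a\<rangle> \<cdot> \<partial>\<^sub>x))
          ((\<langle>(1 - e) / 2\<rangle> + \<langle>(1 + e) / 2\<rangle> \<cdot> Dw \<cdot> Dw) \<cdot> Dg
             + \<langle>a * e\<rangle> \<cdot> (\<lblot>P\<rblot> - \<lblot>Q\<rblot> \<cdot> Dw \<cdot> Dw) \<cdot> Dg \<cdot> \<partial>\<^sub>x) \<and>
        field_boundary_condition Phi Dom W
          (Df \<cdot> Dw \<cdot> (\<langle>1\<rangle> + \<langle>a\<rangle> \<cdot> \<partial>\<^sub>x) \<cdot> \<partial>\<^sub>x)
          ((\<langle>(1 + e) / 2\<rangle> + \<langle>(1 - e) / 2\<rangle> \<cdot> Dw \<cdot> Dw) \<cdot> Dg \<cdot> \<partial>\<^sub>x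
             - \<langle>a * e\<rangle> \<cdot> (\<lblot>Q\<rblot> - \<lblot>P\<rblot> \<cdot> Dw \<cdot> Dw) \<cdot> Dg \<cdot> \<partial>\<^sub>x \<cdot> \<partial>\<^sub>x))"
proof -
  \<comment> \<open>The context repeats the hypotheses of the theorem verbatim, so they discharge it
    directly.\<close>
  interpret defect E A B C \<omega> \<epsilon> \<rho> \<tau> f g R T Phi Dom chi W e Df Dg Dw P Q decay
    by unfold_locales (fact assms)+
  show ?thesis
    using scalar_matrices diagonal_matrices mixed_matrices by blast
qed

end
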